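(* Let $n,N\ge 1$ be integers. For $0\le k\le N$ let $A_k,B_k$ be real $n\times n$ matrices such that $B_k$ and $I+A_k$ are invertible, and let $Q_k$ be real symmetric $n\times n$ matrices. Consider the linear space of pairs $(x,u)$ with $x=(x_0,\dots,x_{N+1})$, $u=(u_0,\dots,u_N)$, $x_k,u_k\in\mathbb{R}^n$, satisfying $$x_{k+1}-x_k=A_kx_k+B_ku_k,\quad 0\le k\le N,\qquad x_0=x_{N+1}=0,$$ and on this space the quadratic form $$\mathcal{J}(u)=\frac12\sum_{i=0}^N\left(|u_i|^2-\langle Q_ix_i,x_i\rangle\right).$$ Then the negative inertia index $ind^-\mathcal{J}$ of this quadratic form on this space is $$ind^-\mathcal{J}=\sum_{k=1}^N\left(ind^-\mathcal{Q}_k^\perp+\dim\ker\Phi_k^3\right),$$ where $$\mathcal{Q}_k^\perp=(\Phi_k^3)^t\left((P_k^{k+1})^t\Gamma_k^{-1}P_k^{k+1}-Q_k\right)\Phi_k^3+(\Phi_k^3)^t\Phi_k^1,$$ and $P_k^{k+1},\Gamma_k,\Phi_k^1,\Phi_k^3$ are the $n\times n$ matrices built from $A_k,B_k,Q_k$ as defined in the context.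
   Context: $I$ is the $n\times n$ identity matrix and ${}^t$ denotes transpose. The negative inertia index $ind^-$ of a quadratic form (or of a symmetric matrix) on a finite-dimensional real space is the maximal dimension of a subspace on which it is negative definite (the number of negative eigenvalues). For $0\le k\le N$ set $\Gamma_k=B_kB_k^t$ (so $\Gamma_k^{-1}=(B_k^{-1})^tB_k^{-1}$), $P_k^{k+1}=I+A_k$ and $P_{k+1}^k=(I+A_k)^{-1}$. Define the $2n\times2n$ matrices $$M_k=\begin{pmatrix}(P_{k+1}^k)^t&0\\ \Gamma_k(P_{k+1}^k)^t&P_k^{k+1}\end{pmatrix}\begin{pmatrix}I&-Q_k\\0&I\end{pmatrix},\qquad 0\le k\le N,$$ and, for $1\le k\le N+1$, the ordered product $$\Phi_k=M_{k-1}M_{k-2}\cdots M_0=\begin{pmatrix}\Phi_k^1&\Phi_k^2\\ \Phi_k^3&\Phi_k^4\end{pmatrix}$$ written in $n\times n$ blocks. *)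

theory Defs
  imports "HOL-Analysis.Analysis" "HOL-Analysis.Finite_Function_Topology"
begin

definition negative_definite_on :: "'v::real_vector set \<Rightarrow> ('v \<Rightarrow> real) \<Rightarrow> bool" where
  "negative_definite_on W q \<longleftrightarrow> (\<forall>w\<in>W. w \<noteq> 0 \<longrightarrow> q w < 0)"

(* Negative inertia index of q on the subspace V.  The maximum is attained when V is
   finite-dimensional; no meaning is attached to it otherwise. *)
definition neg_index :: "'v::real_vector set \<Rightarrow> ('v \<Rightarrow> real) \<Rightarrow> nat" where
  "neg_index V q = Max {dim W | W. subspace W \<and> W \<subseteq> V \<and> negative_definite_on W q}"

definition neg_index_matrix :: "real ^ 'n ^ 'n \<Rightarrow> nat" where
  "neg_index_matrix S = neg_index UNIV (\<lambda>v. (S *v v) \<bullet> v)"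

(* block a b c d is the 2n x 2n matrix with first block row (a, b) and second block row (c, d);
   the index type 'n + 'n lists the first n coordinates as Inl and the last n as Inr. *)
definition block ::
  "real ^ 'n ^ 'n \<Rightarrow> real ^ 'n ^ 'n \<Rightarrow> real ^ 'n ^ 'n \<Rightarrow> real ^ 'n ^ 'n
    \<Rightarrow> real ^ ('n + 'n) ^ ('n + 'n)" where
  "block a b c d = (\<chi> i j.
     case i of
       Inl i' \<Rightarrow> (case j of Inl j' \<Rightarrow> a $ i' $ j' | Inr j' \<Rightarrow> b $ i' $ j')
     | Inr i' \<Rightarrow> (case j of Inl j' \<Rightarrow> c $ i' $ j' | Inr j' \<Rightarrow> d $ i' $ j'))"

definition block_ul :: "real ^ ('n + 'n) ^ ('n + 'n) \<Rightarrow> real ^ 'n ^ 'n" where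
  "block_ul M = (\<chi> i j. M $ Inl i $ Inl j)"

definition block_ll :: "real ^ ('n + 'n) ^ ('n + 'n) \<Rightarrow> real ^ 'n ^ 'n" where
  "block_ll M = (\<chi> i j. M $ Inr i $ Inl j)"

definition Gam :: "(nat \<Rightarrow> real ^ 'n ^ 'n) \<Rightarrow> nat \<Rightarrow> real ^ 'n ^ 'n" where
  "Gam B k = B k ** transpose (B k)"

(* P_fwd A k is P_k^{k+1} and P_bwd A k is P_{k+1}^k. *)
definition P_fwd :: "(nat \<Rightarrow> real ^ 'n ^ 'n) \<Rightarrow> nat \<Rightarrow> real ^ 'n ^ 'n" where
  "P_fwd A k = mat 1 + A k"

definition P_bwd :: "(nat \<Rightarrow> real ^ 'n ^ 'n) \<Rightarrow> nat \<Rightarrow> real ^ 'n ^ 'n" where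
  "P_bwd A k = matrix_inv (mat 1 + A k)"

definition M_mat ::
  "(nat \<Rightarrow> real ^ 'n ^ 'n) \<Rightarrow> (nat \<Rightarrow> real ^ 'n ^ 'n) \<Rightarrow> (nat \<Rightarrow> real ^ 'n ^ 'n)
    \<Rightarrow> nat \<Rightarrow> real ^ ('n + 'n) ^ ('n + 'n)" where
  "M_mat A B Q k =
     block (transpose (P_bwd A k)) 0
           (Gam B k ** transpose (P_bwd A k)) (P_fwd A k)
     ** block (mat 1) (- Q k) 0 (mat 1)"

(* Phi A B Q k = M_{k-1} ** ... ** M_0. *)
primrec Phi ::
  "(nat \<Rightarrow> real ^ 'n ^ 'n) \<Rightarrow> (nat \<Rightarrow> real ^ 'n ^ 'n) \<Rightarrow> (nat \<Rightarrow> real ^ 'n ^ 'n)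
    \<Rightarrow> nat \<Rightarrow> real ^ ('n + 'n) ^ ('n + 'n)" where
  "Phi A B Q 0 = mat 1"
| "Phi A B Q (Suc k) = M_mat A B Q k ** Phi A B Q k"

definition Phi1 ::
  "(nat \<Rightarrow> real ^ 'n ^ 'n) \<Rightarrow> (nat \<Rightarrow> real ^ 'n ^ 'n) \<Rightarrow> (nat \<Rightarrow> real ^ 'n ^ 'n)
    \<Rightarrow> nat \<Rightarrow> real ^ 'n ^ 'n" where
  "Phi1 A B Q k = block_ul (Phi A B Q k)"

definition Phi3 ::
  "(nat \<Rightarrow> real ^ 'n ^ 'n) \<Rightarrow> (nat \<Rightarrow> real ^ 'n ^ 'n) \<Rightarrow> (nat \<Rightarrow> real ^ 'n ^ 'n)
    \<Rightarrow> nat \<Rightarrow> real ^ 'n ^ 'n" where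
  "Phi3 A B Q k = block_ll (Phi A B Q k)"

definition Q_perp ::
  "(nat \<Rightarrow> real ^ 'n ^ 'n) \<Rightarrow> (nat \<Rightarrow> real ^ 'n ^ 'n) \<Rightarrow> (nat \<Rightarrow> real ^ 'n ^ 'n)
    \<Rightarrow> nat \<Rightarrow> real ^ 'n ^ 'n" where
  "Q_perp A B Q k =
     transpose (Phi3 A B Q k)
       ** (transpose (P_fwd A k) ** matrix_inv (Gam B k) ** P_fwd A k - Q k)
       ** Phi3 A B Q k
     + transpose (Phi3 A B Q k) ** Phi1 A B Q k"

(* Finite sequences (x_0, ..., x_{N+1}) and (u_0, ..., u_N) are encoded as finitely supported
   functions on nat vanishing beyond the last index; this type is a real vector space. *)
type_synonym 'n seq = "nat \<Rightarrow>\<^sub>0 real ^ 'n"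

definition admissible ::
  "nat \<Rightarrow> (nat \<Rightarrow> real ^ 'n ^ 'n) \<Rightarrow> (nat \<Rightarrow> real ^ 'n ^ 'n) \<Rightarrow> ('n seq \<times> 'n seq) set" where
  "admissible N A B = {(x, u).
     (\<forall>k > N + 1. Poly_Mapping.lookup x k = 0) \<and>
     (\<forall>k > N. Poly_Mapping.lookup u k = 0) \<and>
     (\<forall>k \<le> N. Poly_Mapping.lookup x (k + 1) - Poly_Mapping.lookup x k
        = A k *v Poly_Mapping.lookup x k + B k *v Poly_Mapping.lookup u k) \<and>
     Poly_Mapping.lookup x 0 = 0 \<and> Poly_Mapping.lookup x (N + 1) = 0}"

lemma subspace_admissible: "subspace (admissible N A B)"
proof -
  have lookup_scaleR: "Poly_Mapping.lookup (c *\<^sub>R x) k = c *\<^sub>R Poly_Mapping.lookup x k"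
    for c and x :: "('n::finite) seq" and k
  proof -
    have "finite {i. c *\<^sub>R Poly_Mapping.lookup x i \<noteq> 0}"
      by (rule finite_subset[OF _ finite_lookup[of x]]) auto
    then show ?thesis
      by (simp add: scaleR_poly_mapping_def Abs_poly_mapping_inverse)
  qed
  show ?thesis
    unfolding subspace_def admissible_def
    by (auto simp: lookup_add lookup_scaleR matrix_vector_right_distrib
          matrix_vector_mult_scaleR zero_prod_def algebra_simps simp flip: scaleR_add_right)
qed

definition J_form :: "nat \<Rightarrow> (nat \<Rightarrow> real ^ 'n ^ 'n) \<Rightarrow> 'n seq \<times> 'n seq \<Rightarrow> real" where
  "J_form N Q = (\<lambda>(x, u). 1 / 2 * (\<Sum>i = 0..N.
     (norm (Poly_Mapping.lookup u i))\<^sup>2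
     - (Q i *v Poly_Mapping.lookup x i) \<bullet> Poly_Mapping.lookup x i))"

end

theory Submission
  imports Defs
begin

text \<open>
  The index is computed one time step at a time. Write \<open>V\<^sub>m\<close> for the admissible pairs with horizon
  \<open>m\<close>. Extending a pair by zero embeds \<open>V\<^sub>m\<close> into \<open>V\<^sub>m\<^sub>+\<^sub>1\<close>, with the same value of the cost,
  so it suffices to see how the index grows from \<open>W = V\<^sub>m\<close> to \<open>V = V\<^sub>m\<^sub>+\<^sub>1\<close>.

  For any symmetric bilinear form on a finite-dimensional \<open>V\<close> and any subspace \<open>W\<close> that meets the
  radical of \<open>V\<close> only in \<open>0\<close>, the index of \<open>V\<close> is the index of \<open>W\<close>, plus the index of the
  orthogonal complement \<open>U\<close> of \<open>W\<close> in \<open>V\<close>, plus \<open>dim (W \<inter> U)\<close>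
  (\<open>neg_index_orthogonal_decomposition\<close>). The last summand appears because \<open>W \<inter> U\<close> is
  isotropic, yet pairs nontrivially with the rest of \<open>V\<close>, so that each of its dimensions generates
  a hyperbolic plane and contributes one negative direction.

  In the control problem, orthogonality to \<open>W\<close> is the discrete Euler-Lagrange equation at the inner
  times, which is the recursion defining \<open>\<Phi>\<^sub>k\<close>. Hence \<open>U\<close> consists of the trajectories
  \<open>x\<^sub>k = \<Phi>\<^sub>k\<^sup>3 v\<close> for \<open>k \<le> m + 1\<close>, with initial costate \<open>v\<close>, whose last control
  brings the state back to \<open>0\<close> (\<open>orthogonal_complement_eq_trajectories\<close>). Summation by parts
  evaluates the cost on such a trajectory from its last step alone, with the result
  \<open>\<langle>\<Q>\<^sub>m\<^sub>+\<^sub>1\<^sup>\<bottom> v, v\<rangle> / 2\<close> (\<open>J_form_trajectory\<close>), and the trajectory lies in \<open>W\<close>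
  exactly when its state at time \<open>m + 1\<close> vanishes, that is, when \<open>v\<close> is in the kernel of
  \<open>\<Phi>\<^sub>m\<^sub>+\<^sub>1\<^sup>3\<close> (\<open>trajectory_mem_iff\<close>). An element of \<open>W\<close> in the radical of \<open>V\<close>
  satisfies the Euler-Lagrange equations up to the final time, where state and control are zero;
  solving them backwards shows that it is \<open>0\<close> (\<open>no_radical_in_shorter_horizon\<close>).
\<close>

section \<open>Dimension counts in finitely generated subspaces\<close>

text \<open>The space of pairs of sequences is infinite-dimensional, so dimensions
  are compared inside a finitely generated subspace \<open>span F\<close> of an arbitrary real vector space.\<close>
lemma dim_mono_in_span:
  fixes S T F :: "'v::real_vector set"
  assumes "S \<subseteq> T" "T \<subseteq> span F" "finite F"
  shows "dim S \<le> dim T"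
proof -
  obtain B where B: "B \<subseteq> S" "independent B" "S \<subseteq> span B" "card B = dim S"
    using real_vector.basis_exists by blast
  obtain C where C: "C \<subseteq> T" "independent C" "T \<subseteq> span C" "card C = dim T"
    using real_vector.basis_exists by blast
  have "finite C"
    using real_vector.independent_span_bound[OF \<open>finite F\<close> C(2)] C(1) assms(2) by blast
  then have "card B \<le> card C"
    using real_vector.independent_span_bound[OF _ B(2)] B(1) C(3) assms(1) by blast
  then show ?thesis using B C by simp
qed

lemma finite_basis_in_span:
  fixes V F :: "'v::real_vector set"
  assumes "V \<subseteq> span F" "finite F"
  shows "\<exists>B. B \<subseteq> V \<and> independent B \<and> V \<subseteq> span B \<and> card B = dim V \<and> finite B"
proof -
  obtain B where B: "B \<subseteq> V" "independent B" "V \<subseteq> span B" "card B = dim V"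
    using real_vector.basis_exists by blast
  moreover have "finite B"
    using real_vector.independent_span_bound[OF \<open>finite F\<close> B(2)] B(1) assms(1) by blast
  ultimately show ?thesis by blast
qed

text \<open>Rank-nullity in a form that also proves \<open>V\<close> to be finitely generated: preimages of a basis of
  the image, together with generators of the kernel, generate \<open>V\<close>.\<close>
lemma spanning_set_from_kernel_and_image:
  fixes f :: "'v::real_vector \<Rightarrow> 'w::real_vector"
  assumes f: "linear f" and V: "subspace V"
    and S: "finite S" "{v \<in> V. f v = 0} \<subseteq> span S"
    and C: "finite C" "f ` V \<subseteq> span C"
  shows "\<exists>T. finite T \<and> card T \<le> card S + dim (f ` V) \<and> V \<subseteq> span T"
proof -
  obtain B where B: "B \<subseteq> f ` V" "f ` V \<subseteq> span B" "card B = dim (f ` V)" "finite B"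
    using finite_basis_in_span[OF C(2,1)] by metis
  have "\<forall>b\<in>B. \<exists>v. v \<in> V \<and> f v = b" using B(1) by blast
  then obtain g where g: "\<forall>b\<in>B. g b \<in> V \<and> f (g b) = b" by metis
  have fg: "f ` g ` B = B" using g by (simp add: image_image)
  have "g ` B \<subseteq> V" using g by blast
  then have gV: "span (g ` B) \<subseteq> V" using V by (rule span_minimal)
  have "v \<in> span (S \<union> g ` B)" if v: "v \<in> V" for v
  proof -
    have "f v \<in> span B" using v B(2) by (meson imageI subsetD)
    also have "span B = f ` span (g ` B)" using linear_span_image[OF f, of "g ` B"] fg by simp
    finally have "f v \<in> f ` span (g ` B)" .
    then obtain w where w: "w \<in> span (g ` B)" "f v = f w" by blast
    have "v - w \<in> V" using v w(1) gV V subspace_diff by blast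
    moreover have "f (v - w) = 0" using w(2) by (simp add: linear_diff[OF f])
    ultimately have "v - w \<in> span S" using S(2) by (metis (mono_tags, lifting) mem_Collect_eq subsetD)
    then have "(v - w) + w \<in> span (S \<union> g ` B)"
      using w(1) by (meson span_add span_mono subsetD sup_ge1 sup_ge2)
    then show ?thesis by simp
  qed
  moreover have "card (S \<union> g ` B) \<le> card S + dim (f ` V)"
    using card_Un_le[of S "g ` B"] card_image_le[OF B(4), of g] B(3) by linarith
  ultimately show ?thesis using S(1) B(4) by (intro exI[of _ "S \<union> g ` B"]) auto
qed

lemma dim_le_dim_kernel_plus_dim_image:
  fixes f :: "'v::real_vector \<Rightarrow> 'w::real_vector"
  assumes f: "linear f" and V: "subspace V" "V \<subseteq> span F" "finite F"
  shows "dim V \<le> dim {v \<in> V. f v = 0} + dim (f ` V)"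
proof -
  obtain S where S: "finite S" "{v \<in> V. f v = 0} \<subseteq> span S" "card S = dim {v \<in> V. f v = 0}"
    using finite_basis_in_span[of "{v \<in> V. f v = 0}" F] V(2,3) by (metis (no_types, lifting) mem_Collect_eq subset_iff)
  have "f ` V \<subseteq> span (f ` F)"
    using V(2) linear_span_image[OF f, of F] by auto
  then obtain T where "finite T" "card T \<le> card S + dim (f ` V)" "V \<subseteq> span T"
    using spanning_set_from_kernel_and_image[OF f V(1) S(1,2), of "f ` F"] V(3) by auto
  then show ?thesis
    using real_vector.dim_le_card[of V T] S(3) by linarith
qed

lemma dim_image_inj_on:
  fixes f :: "'v::real_vector \<Rightarrow> 'w::real_vector"
  assumes f: "linear f" and "subspace V" "inj_on f V"
  shows "dim (f ` V) = dim V"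
proof -
  obtain B where B: "B \<subseteq> V" "independent B" "V \<subseteq> span B" "card B = dim V"
    using real_vector.basis_exists by blast
  have sp: "span B = V" using B assms(2) span_subspace by blast
  have "independent (f ` B)"
    using linear_independent_injective_image[OF f B(2)] assms(3) sp by simp
  moreover have "f ` V = span (f ` B)" using linear_span_image[OF f, of B] sp by simp
  moreover have "card (f ` B) = card B"
    using assms(3) B(1) by (intro card_image) (rule inj_on_subset)
  ultimately show ?thesis using B(4) real_vector.dim_span_eq_card_independent by metis
qed

text \<open>The complement is the kernel in \<open>S\<close> of a linear projection onto \<open>K\<close>.\<close>
lemma complement_in_subspace:
  fixes S K F :: "'v::real_vector set"
  assumes S: "subspace S" "S \<subseteq> span F" "finite F" and K: "subspace K" "K \<subseteq> S"
  obtains C where "subspace C" "C \<subseteq> S" "C \<inter> K = {0}" "dim S \<le> dim C + dim K"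
proof -
  obtain B where B: "B \<subseteq> K" "independent B" "K \<subseteq> span B"
    using real_vector.basis_exists[of K] by metis
  have sp: "span B = K" using B K(1) span_subspace by blast
  obtain f :: "'v \<Rightarrow> 'v" where f: "linear f" "\<forall>x\<in>B. f x = id x" "range f = span (id ` B)"
    using linear_independent_extend_subspace[OF B(2), of id] by metis
  have fK: "f x = x" if "x \<in> K" for x
    using real_vector.linear_eq_on[OF f(1) linear_id, of x B] f(2) that sp by simp
  have "f ` S \<subseteq> K" using f(3) sp by auto
  moreover have "K \<subseteq> f ` S"
  proof
    fix x assume "x \<in> K"
    then show "x \<in> f ` S" using fK[of x] K(2) by (intro image_eqI[of _ _ x]) auto
  qed
  ultimately have img: "f ` S = K" by blast
  let ?C = "{v \<in> S. f v = 0}"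
  have "subspace ?C"
    using S(1) linear_subspace_kernel[OF f(1)] subspace_inter by (simp add: Collect_conj_eq)
  moreover have "?C \<inter> K = {0}"
    using fK S(1) K(1) linear_0[OF f(1)] by (auto simp: subspace_0)
  moreover have "dim S \<le> dim ?C + dim K"
    using dim_le_dim_kernel_plus_dim_image[OF f(1) S] img by simp
  ultimately show thesis using that[of ?C] by blast
qed

lemma dim_add_le_of_disjoint:
  fixes S T V F :: "'v::real_vector set"
  assumes S: "subspace S" "S \<subseteq> V" and T: "subspace T" "T \<subseteq> V"
    and V: "V \<subseteq> span F" "finite F" and disj: "S \<inter> T \<subseteq> {0}"
  shows "dim S + dim T \<le> dim V"
proof -
  obtain B where B: "B \<subseteq> S" "independent B" "S \<subseteq> span B" "card B = dim S" "finite B"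
    using finite_basis_in_span[of S F] S V by blast
  obtain C where C: "C \<subseteq> T" "independent C" "T \<subseteq> span C" "card C = dim T" "finite C"
    using finite_basis_in_span[of T F] T V by blast
  have "0 \<notin> B" using B(2) real_vector.dependent_zero by blast
  moreover have "B \<inter> C \<subseteq> {0}" using B(1) C(1) disj by (meson Int_mono subset_trans)
  ultimately have BC: "B \<inter> C = {}" by blast
  have "independent (B \<union> C)"
  proof (rule real_vector.independent_if_scalars_zero)
    show "finite (B \<union> C)" using B C by simp
    fix u x assume 0: "(\<Sum>x\<in>B \<union> C. u x *\<^sub>R x) = 0" and x: "x \<in> B \<union> C"
    let ?s = "\<Sum>x\<in>B. u x *\<^sub>R x" and ?t = "\<Sum>x\<in>C. u x *\<^sub>R x"
    have st: "?s + ?t = 0" using 0 sum.union_disjoint[OF B(5) C(5) BC] by metis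
    have "?s \<in> S" using S(1) B(1) by (intro subspace_sum subspace_scale) auto
    moreover have "?t \<in> T" using T(1) C(1) by (intro subspace_sum subspace_scale) auto
    moreover have "?s = - ?t" using st by (simp add: eq_neg_iff_add_eq_0)
    ultimately have "?s \<in> S \<inter> T" using subspace_neg[OF T(1)] by (metis IntI)
    then have "?s = 0" "?t = 0" using st disj by auto
    then show "u x = 0"
      using x real_vector.independentD[OF B(2) B(5) subset_refl]
        real_vector.independentD[OF C(2) C(5) subset_refl] by blast
  qed
  then have "card (B \<union> C) = dim (B \<union> C)" by (simp add: real_vector.dim_eq_card_independent)
  also have "\<dots> \<le> dim V" using B(1) C(1) S(2) T(2) V by (intro dim_mono_in_span) auto
  finally show ?thesis using B(4) C(4) card_Un_disjoint[OF B(5) C(5) BC] by simp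
qed

lemma dim_sums_ge_of_disjoint:
  fixes S T V F :: "'v::real_vector set"
  assumes S: "subspace S" "S \<subseteq> V" and T: "subspace T" "T \<subseteq> V"
    and V: "subspace V" "V \<subseteq> span F" "finite F" and disj: "S \<inter> T \<subseteq> {0}"
  shows "dim S + dim T \<le> dim {x + y | x y. x \<in> S \<and> y \<in> T}"
proof (rule dim_add_le_of_disjoint[OF S(1) _ T(1) _ _ V(3) disj])
  show "S \<subseteq> {x + y | x y. x \<in> S \<and> y \<in> T}" using subspace_0[OF T(1)] by force
  show "T \<subseteq> {x + y | x y. x \<in> S \<and> y \<in> T}" using subspace_0[OF S(1)] by force
  have "{x + y | x y. x \<in> S \<and> y \<in> T} \<subseteq> V" using S(2) T(2) V(1) by (auto intro!: subspace_add)
  then show "{x + y | x y. x \<in> S \<and> y \<in> T} \<subseteq> span F" using V(2) by (rule subset_trans)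
qed

lemma subspace_eq_of_dim_ge:
  fixes S V F :: "'v::real_vector set"
  assumes S: "subspace S" "S \<subseteq> V" and V: "subspace V" "V \<subseteq> span F" "finite F"
    and d: "dim V \<le> dim S"
  shows "S = V"
proof (rule ccontr)
  assume "S \<noteq> V"
  then obtain v where v: "v \<in> V" "v \<notin> S" using S(2) by blast
  then have "v \<noteq> 0" using subspace_0[OF S(1)] by blast
  have "span {v} \<inter> S \<subseteq> {0}"
  proof
    fix x assume x: "x \<in> span {v} \<inter> S"
    then obtain c where c: "x = c *\<^sub>R v" by (auto simp: span_singleton)
    have "c = 0"
    proof (rule ccontr)
      assume "c \<noteq> 0"
      then have "v = inverse c *\<^sub>R x" using c by simp
      then show False using v(2) x subspace_scale[OF S(1)] by simp
    qed
    then show "x \<in> {0}" using c by simp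
  qed
  moreover have "span {v} \<subseteq> V" using v(1) V(1) by (intro span_minimal) auto
  ultimately have "dim (span {v}) + dim S \<le> dim V"
    using S V by (intro dim_add_le_of_disjoint[where F = F]) auto
  moreover have "dim (span {v}) = 1"
    using \<open>v \<noteq> 0\<close> real_vector.dim_span_eq_card_independent[of "{v}"] by simp
  ultimately show False using d by linarith
qed

section \<open>The negative index of a symmetric bilinear form\<close>

text \<open>Each basis vector of \<open>W\<close> imposes one linear condition on \<open>V\<close>. Using the vector itself as the
  coefficient of its condition in \<open>f\<close> puts the image of \<open>f\<close> into \<open>W\<close>, so its dimension is
  bounded at once.\<close>
lemma dim_le_dim_plus_dim_orthogonal:
  fixes b :: "'v::real_vector \<Rightarrow> 'v \<Rightarrow> real"
  assumes b: "bilinear b" and V: "subspace V" "V \<subseteq> span F" "finite F"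
    and W: "subspace W" "W \<subseteq> V"
  shows "dim V \<le> dim W + dim {v \<in> V. \<forall>w\<in>W. b v w = 0}"
proof -
  obtain B where B: "B \<subseteq> W" "independent B" "W \<subseteq> span B" "finite B"
    using finite_basis_in_span[of W F] W V by blast
  define f where "f v = (\<Sum>e\<in>B. b v e *\<^sub>R e)" for v
  have f: "linear f"
    unfolding f_def
    by (rule linearI) (simp_all add: bilinear_ladd[OF b] bilinear_lmul[OF b] scaleR_add_left
        sum.distrib scaleR_right.sum)
  have ker: "{v \<in> V. f v = 0} = {v \<in> V. \<forall>w\<in>W. b v w = 0}"
  proof (intro Collect_cong conj_cong refl iffI)
    fix v assume "f v = 0"
    then have "b v e = 0" if "e \<in> B" for e
      using real_vector.independentD[OF B(2) B(4) subset_refl] that unfolding f_def by blast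
    moreover have "linear (b v)" using b by (simp add: bilinear_def)
    ultimately show "\<forall>w\<in>W. b v w = 0"
      using B(3) linear_eq_0_on_span[of "b v" B] by blast
  next
    fix v assume "\<forall>w\<in>W. b v w = 0"
    then show "f v = 0" using B(1) by (auto simp: f_def intro!: sum.neutral)
  qed
  have "f ` V \<subseteq> W"
    using W(1) B(1) unfolding f_def by (auto intro!: subspace_sum subspace_scale)
  then have "dim (f ` V) \<le> dim W" using W V by (intro dim_mono_in_span[where F = F]) auto
  then show ?thesis
    using dim_le_dim_kernel_plus_dim_image[OF f V] unfolding ker by linarith
qed

lemma subspace_orthogonal_in:
  fixes b :: "'v::real_vector \<Rightarrow> 'v \<Rightarrow> real"
  assumes "bilinear b" "subspace V"
  shows "subspace {v \<in> V. \<forall>w\<in>W. b v w = 0}"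
  using assms(2)
  by (auto simp: subspace_def bilinear_ladd[OF assms(1)] bilinear_lmul[OF assms(1)]
      bilinear_lzero[OF assms(1)])

lemma form_add:
  fixes b :: "'v::real_vector \<Rightarrow> 'v \<Rightarrow> real"
  assumes "bilinear b" "\<And>x y. b x y = b y x"
  shows "b (x + y) (x + y) = b x x + 2 * b x y + b y y"
  by (simp add: bilinear_ladd[OF assms(1)] bilinear_radd[OF assms(1)] assms(2)[of y x])

lemma neg_index_attained:
  fixes q :: "'v::real_vector \<Rightarrow> real"
  assumes V: "subspace V" "V \<subseteq> span F" "finite F"
  obtains N where "subspace N" "N \<subseteq> V" "negative_definite_on N q" "dim N = neg_index V q"
    "\<And>M. subspace M \<Longrightarrow> M \<subseteq> V \<Longrightarrow> negative_definite_on M q \<Longrightarrow> dim M \<le> dim N"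
proof -
  let ?D = "{dim W | W. subspace W \<and> W \<subseteq> V \<and> negative_definite_on W q}"
  have "?D \<subseteq> {..dim V}" using dim_mono_in_span[OF _ V(2,3)] by auto
  then have fin: "finite ?D" using finite_subset by blast
  have "dim {0::'v} \<in> ?D"
    using V(1) by (force simp: negative_definite_on_def subspace_0)
  then have "Max ?D \<in> ?D" using fin Max_in by blast
  then obtain N where N: "Max ?D = dim N" "subspace N" "N \<subseteq> V" "negative_definite_on N q" by blast
  have "dim M \<le> dim N" if "subspace M" "M \<subseteq> V" "negative_definite_on M q" for M
    using Max_ge[OF fin, of "dim M"] that N(1) by auto
  then show thesis using that[of N] N unfolding neg_index_def by auto
qed

lemma neg_index_zero_space: "neg_index {0::'v::real_vector} q = 0"
proof -
  have "subspace W \<Longrightarrow> W \<subseteq> {0} \<Longrightarrow> W = {0}" for W :: "'v set"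
    using subspace_0 by blast
  moreover have "dim {0::'v} = 0" using real_vector.dim_le_card[of "{0}" "{}"] by simp
  ultimately have "{dim W | W. subspace W \<and> W \<subseteq> {0::'v} \<and> negative_definite_on W q} = {0}"
    by (auto simp: negative_definite_on_def)
  then show ?thesis by (simp add: neg_index_def)
qed

text \<open>Sylvester's splitting. A negative definite subspace \<open>N\<close> of maximal dimension has a positive
  semidefinite orthogonal complement, since a negative vector orthogonal to \<open>N\<close> would enlarge \<open>N\<close>.
  The form is nondegenerate on \<open>N\<close>, so the two span \<open>V\<close>.\<close>
lemma neg_index_splitting:
  fixes b :: "'v::real_vector \<Rightarrow> 'v \<Rightarrow> real"
  assumes b: "bilinear b" and sym: "\<And>x y. b x y = b y x"
    and V: "subspace V" "V \<subseteq> span F" "finite F"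
  obtains N P where
    "subspace N" "N \<subseteq> V" "negative_definite_on N (\<lambda>x. b x x)" "dim N = neg_index V (\<lambda>x. b x x)"
    "subspace P" "P \<subseteq> V" "\<And>x. x \<in> P \<Longrightarrow> 0 \<le> b x x"
    "\<And>x y. x \<in> N \<Longrightarrow> y \<in> P \<Longrightarrow> b x y = 0"
    "dim V \<le> dim N + dim P" "V = {x + y | x y. x \<in> N \<and> y \<in> P}"
proof -
  obtain N where N: "subspace N" "N \<subseteq> V" "negative_definite_on N (\<lambda>x. b x x)"
      "dim N = neg_index V (\<lambda>x. b x x)"
    and maxN: "\<And>M. subspace M \<Longrightarrow> M \<subseteq> V \<Longrightarrow> negative_definite_on M (\<lambda>x. b x x) \<Longrightarrow> dim M \<le> dim N"
    by (rule neg_index_attained[OF V, of "\<lambda>x. b x x"]) (rule that)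
  define P where "P = {v \<in> V. \<forall>w\<in>N. b v w = 0}"
  have P: "subspace P" "P \<subseteq> V"
    unfolding P_def using subspace_orthogonal_in[OF b V(1)] by auto
  have NP: "b x y = 0" if "x \<in> N" "y \<in> P" for x y
    using that sym unfolding P_def by auto
  have dims: "dim V \<le> dim N + dim P"
    unfolding P_def by (rule dim_le_dim_plus_dim_orthogonal[OF b V N(1,2)])
  have disj: "N \<inter> P \<subseteq> {0}"
  proof
    fix x assume "x \<in> N \<inter> P"
    then show "x \<in> {0}" using NP[of x x] N(3) by (force simp: negative_definite_on_def)
  qed
  have psd: "0 \<le> b p p" if p: "p \<in> P" for p
  proof (rule ccontr)
    assume neg: "\<not> 0 \<le> b p p"
    then have p0: "p \<noteq> 0" by (auto simp: bilinear_lzero[OF b])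
    have sp: "span {p} \<subseteq> P" using p P(1) by (intro span_minimal) auto
    let ?M = "{x + y | x y. x \<in> N \<and> y \<in> span {p}}"
    have "subspace ?M" using N(1) by (intro subspace_sums) auto
    moreover have "?M \<subseteq> V" using N(2) sp P(2) V(1) by (auto intro!: subspace_add)
    moreover have "negative_definite_on ?M (\<lambda>x. b x x)"
      unfolding negative_definite_on_def
    proof (intro ballI impI)
      fix m assume "m \<in> ?M" and m0: "m \<noteq> 0"
      then obtain n c where m: "m = n + c *\<^sub>R p" and n: "n \<in> N" by (auto simp: span_singleton)
      have "b n p = 0" using NP[OF n p] .
      then have "b m m = b n n + c\<^sup>2 * b p p"
        unfolding m form_add[OF b sym]
        by (simp add: bilinear_lmul[OF b] bilinear_rmul[OF b] power2_eq_square)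
      moreover have "b n n < 0 \<or> n = 0" using n N(3) by (auto simp: negative_definite_on_def)
      moreover have "c\<^sup>2 * b p p < 0 \<or> c = 0" using neg by (auto simp: mult_less_0_iff)
      ultimately show "b m m < 0" using m m0 by (auto simp: bilinear_lzero[OF b])
    qed
    ultimately have "dim ?M \<le> dim N" by (rule maxN)
    moreover have "dim N + dim (span {p}) \<le> dim ?M"
      using N(1,2) sp P(2) V disj by (intro dim_sums_ge_of_disjoint[where V = V and F = F]) auto
    moreover have "dim (span {p}) = 1"
      using p0 real_vector.dim_span_eq_card_independent[of "{p}"] by simp
    ultimately show False by linarith
  qed
  have "{x + y | x y. x \<in> N \<and> y \<in> P} = V"
  proof (rule subspace_eq_of_dim_ge[OF _ _ V])
    show "subspace {x + y | x y. x \<in> N \<and> y \<in> P}" using N(1) P(1) by (rule subspace_sums)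
    show "{x + y | x y. x \<in> N \<and> y \<in> P} \<subseteq> V" using N(2) P(2) V(1) by (auto intro!: subspace_add)
    show "dim V \<le> dim {x + y | x y. x \<in> N \<and> y \<in> P}"
      using dims dim_sums_ge_of_disjoint[OF N(1,2) P V disj] by linarith
  qed
  then show thesis using that[OF N P psd NP dims] by simp
qed

text \<open>The Cauchy-Schwarz argument: along the line \<open>x + t k\<close> the form is affine in \<open>t\<close>, and it stays
  nonnegative only if its slope is zero.\<close>
lemma psd_isotropic_imp_radical:
  fixes b :: "'v::real_vector \<Rightarrow> 'v \<Rightarrow> real"
  assumes b: "bilinear b" and sym: "\<And>x y. b x y = b y x"
    and P: "subspace P" "\<And>x. x \<in> P \<Longrightarrow> 0 \<le> b x x"
    and k: "k \<in> P" "b k k = 0" and x: "x \<in> P"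
  shows "b k x = 0"
proof (rule ccontr)
  assume nz: "b k x \<noteq> 0"
  \<comment> \<open>the point at which the affine function takes the value \<open>-1\<close>\<close>
  define t where "t = - (b x x + 1) / (2 * b k x)"
  have "t *\<^sub>R k + x \<in> P" using P(1) k(1) x by (intro subspace_add subspace_scale)
  then have "0 \<le> b (t *\<^sub>R k + x) (t *\<^sub>R k + x)" by (rule P(2))
  also have "\<dots> = 2 * t * b k x + b x x"
    unfolding form_add[OF b sym] using k(2) by (simp add: bilinear_lmul[OF b] bilinear_rmul[OF b])
  also have "\<dots> = -1" using nz by (simp add: t_def field_simps)
  finally show False by simp
qed

text \<open>Both inequalities come from splitting \<open>V\<close>, \<open>W\<close> and \<open>U\<close> into negative definite parts
  \<open>N\<close>, \<open>N1\<close>, \<open>N2\<close> and positive semidefinite parts \<open>P\<close>, \<open>P1\<close>, \<open>P2\<close>.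

  Upper bound: the sum of \<open>P1\<close> and \<open>P2\<close> is positive semidefinite, because \<open>W\<close> and \<open>U\<close> are
  orthogonal. It is disjoint from \<open>N\<close>, and its dimension falls short of \<open>dim P1 + dim P2\<close> by at
  most \<open>dim (W \<inter> U)\<close>; comparison with \<open>dim V \<le> dim W + dim U\<close> bounds \<open>dim N\<close>.

  Lower bound: the form is negative semidefinite on \<open>L = N1 + N2 + (W \<inter> U)\<close>. A vector common to
  \<open>L\<close> and \<open>P\<close> is isotropic, hence lies in \<open>W \<inter> U\<close>, and is orthogonal to \<open>P\<close> as well as to \<open>N\<close>,
  that is, to all of \<open>V\<close>. By \<open>nondeg\<close> it vanishes, so \<open>dim L \<le> dim V - dim P\<close>. This
  avoids the explicit construction of hyperbolic planes around \<open>W \<inter> U\<close>.\<close>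
lemma neg_index_orthogonal_decomposition:
  fixes b :: "'v::real_vector \<Rightarrow> 'v \<Rightarrow> real"
  assumes b: "bilinear b" and sym: "\<And>x y. b x y = b y x"
    and V: "subspace V" "V \<subseteq> span F" "finite F"
    and W: "subspace W" "W \<subseteq> V"
    and U_def: "U = {v \<in> V. \<forall>w\<in>W. b v w = 0}"
    and nondeg: "\<And>k. k \<in> W \<Longrightarrow> (\<And>v. v \<in> V \<Longrightarrow> b k v = 0) \<Longrightarrow> k = 0"
  shows "neg_index V (\<lambda>x. b x x)
    = neg_index W (\<lambda>x. b x x) + neg_index U (\<lambda>x. b x x) + dim (W \<inter> U)"
proof -
  let ?q = "\<lambda>x. b x x"
  have U: "subspace U" "U \<subseteq> V" unfolding U_def using subspace_orthogonal_in[OF b V(1)] by auto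
  have WU: "b w u = 0" if "w \<in> W" "u \<in> U" for w u using that sym unfolding U_def by auto
  obtain N P where N: "subspace N" "N \<subseteq> V" "negative_definite_on N ?q" "dim N = neg_index V ?q"
    and P: "subspace P" "P \<subseteq> V" "\<And>x. x \<in> P \<Longrightarrow> 0 \<le> b x x"
    and NP: "\<And>x y. x \<in> N \<Longrightarrow> y \<in> P \<Longrightarrow> b x y = 0"
    and V_sum: "dim V \<le> dim N + dim P" "V = {x + y | x y. x \<in> N \<and> y \<in> P}"
    by (rule neg_index_splitting[OF b sym V]) (rule that)
  have WF: "W \<subseteq> span F" using W(2) V(2) by blast
  have UF: "U \<subseteq> span F" using U(2) V(2) by blast
  obtain N1 P1 where N1: "subspace N1" "N1 \<subseteq> W" "negative_definite_on N1 ?q" "dim N1 = neg_index W ?q"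
    and P1: "subspace P1" "P1 \<subseteq> W" "\<And>x. x \<in> P1 \<Longrightarrow> 0 \<le> b x x"
    and N1P1: "\<And>x y. x \<in> N1 \<Longrightarrow> y \<in> P1 \<Longrightarrow> b x y = 0"
    and W_sum: "dim W \<le> dim N1 + dim P1" "W = {x + y | x y. x \<in> N1 \<and> y \<in> P1}"
    by (rule neg_index_splitting[OF b sym W(1) WF V(3)]) (rule that)
  obtain N2 P2 where N2: "subspace N2" "N2 \<subseteq> U" "negative_definite_on N2 ?q" "dim N2 = neg_index U ?q"
    and P2: "subspace P2" "P2 \<subseteq> U" "\<And>x. x \<in> P2 \<Longrightarrow> 0 \<le> b x x"
    and N2P2: "\<And>x y. x \<in> N2 \<Longrightarrow> y \<in> P2 \<Longrightarrow> b x y = 0"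
    and U_sum: "dim U \<le> dim N2 + dim P2" "U = {x + y | x y. x \<in> N2 \<and> y \<in> P2}"
    by (rule neg_index_splitting[OF b sym U(1) UF V(3)]) (rule that)
  have K: "subspace (W \<inter> U)" using W(1) U(1) by (rule subspace_inter)
  show ?thesis
  proof (rule antisym)
    \<comment> \<open>the part of \<open>P1\<close> lying in \<open>U\<close> may be contained in \<open>P2\<close>; \<open>C\<close> is what remains of \<open>P1\<close>\<close>
    have "subspace (P1 \<inter> U)" using P1(1) U(1) by (rule subspace_inter)
    then obtain C where C: "subspace C" "C \<subseteq> P1" "C \<inter> (P1 \<inter> U) = {0}" "dim P1 \<le> dim C + dim (P1 \<inter> U)"
      using complement_in_subspace[OF P1(1) _ V(3), of "P1 \<inter> U"] P1(2) WF
      by (metis inf_le1 order_trans)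
    have "dim (P1 \<inter> U) \<le> dim (W \<inter> U)"
      using P1(2) WF V(3) by (intro dim_mono_in_span[where F = F]) auto
    let ?E = "{x + y | x y. x \<in> C \<and> y \<in> P2}"
    have CV: "C \<subseteq> V" and P2V: "P2 \<subseteq> V" using C(2) P1(2) W(2) P2(2) U(2) by auto
    have "dim C + dim P2 \<le> dim ?E"
      using C(1-3) P2(1,2) CV P2V V by (intro dim_sums_ge_of_disjoint[where V = V and F = F]) auto
    moreover have "dim N + dim ?E \<le> dim V"
    proof (rule dim_add_le_of_disjoint[OF N(1,2) _ _ V(2,3)])
      show "subspace ?E" using C(1) P2(1) by (rule subspace_sums)
      show "?E \<subseteq> V" using CV P2V V(1) by (auto intro!: subspace_add)
      show "N \<inter> ?E \<subseteq> {0}"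
      proof
        fix x assume x: "x \<in> N \<inter> ?E"
        then obtain c p where cp: "x = c + p" "c \<in> C" "p \<in> P2" by blast
        have "b c p = 0" using WU[of c p] cp C(2) P1(2) P2(2) by blast
        then have "0 \<le> b x x" using cp C(2) P1(3)[of c] P2(3)[of p] by (auto simp: form_add[OF b sym])
        then show "x \<in> {0}" using x N(3) by (force simp: negative_definite_on_def)
      qed
    qed
    moreover have "dim V \<le> dim W + dim U"
      unfolding U_def by (rule dim_le_dim_plus_dim_orthogonal[OF b V W])
    ultimately show "neg_index V ?q \<le> neg_index W ?q + neg_index U ?q + dim (W \<inter> U)"
      using W_sum(1) U_sum(1) C(4) \<open>dim (P1 \<inter> U) \<le> dim (W \<inter> U)\<close> N(4) N1(4) N2(4) by linarith
  next
    let ?M = "{x + y | x y. x \<in> N1 \<and> y \<in> N2}"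
    let ?L = "{x + y | x y. x \<in> ?M \<and> y \<in> W \<inter> U}"
    have N1V: "N1 \<subseteq> V" and N2V: "N2 \<subseteq> V" using N1(2) N2(2) W(2) U(2) by auto
    have M: "subspace ?M" using N1(1) N2(1) by (rule subspace_sums)
    have MV: "?M \<subseteq> V" using N1V N2V V(1) by (auto intro!: subspace_add)
    have neg: "b m m < 0" if m: "m \<in> ?M" "m \<noteq> 0" for m
    proof -
      obtain x y where xy: "m = x + y" "x \<in> N1" "y \<in> N2" using m(1) by blast
      have "b x y = 0" using WU[of x y] xy N1(2) N2(2) by blast
      moreover have "b x x < 0 \<or> x = 0" "b y y < 0 \<or> y = 0"
        using xy N1(3) N2(3) by (auto simp: negative_definite_on_def)
      ultimately show ?thesis
        using xy(1) m(2) by (auto simp: form_add[OF b sym] bilinear_lzero[OF b])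
    qed
    have "N1 \<inter> N2 \<subseteq> {0}"
    proof
      fix x assume "x \<in> N1 \<inter> N2"
      then show "x \<in> {0}"
        using WU[of x x] N1(2,3) N2(2) by (force simp: negative_definite_on_def)
    qed
    then have "dim N1 + dim N2 \<le> dim ?M"
      using N1(1) N2(1) N1V N2V V by (intro dim_sums_ge_of_disjoint[where V = V and F = F]) auto
    moreover have "?M \<inter> (W \<inter> U) \<subseteq> {0}"
    proof
      fix x assume x: "x \<in> ?M \<inter> (W \<inter> U)"
      then have "b x x = 0" using WU[of x x] by blast
      then show "x \<in> {0}" using neg[of x] x by force
    qed
    then have "dim ?M + dim (W \<inter> U) \<le> dim ?L"
      using W U by (intro dim_sums_ge_of_disjoint[OF M MV K _ V]) auto
    moreover have "dim ?L + dim P \<le> dim V"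
    proof (rule dim_add_le_of_disjoint[OF _ _ P(1,2) V(2,3)])
      show "subspace ?L" using M K by (rule subspace_sums)
      show "?L \<subseteq> V" using MV W(2) V(1) by (blast intro: subspace_add)
      show "?L \<inter> P \<subseteq> {0}"
      proof
        fix x assume x: "x \<in> ?L \<inter> P"
        then obtain m k where mk: "x = m + k" "m \<in> ?M" "k \<in> W" "k \<in> U" by blast
        obtain n1 n2 where n: "m = n1 + n2" "n1 \<in> N1" "n2 \<in> N2" using mk(2) by blast
        have "b n1 k = 0" using WU[of n1 k] n N1(2) mk by blast
        moreover have "b k n2 = 0" using WU[of k n2] n N2(2) mk by blast
        ultimately have "b m k = 0" using sym[of k n2] by (simp add: n(1) bilinear_ladd[OF b])
        moreover have "b k k = 0" using WU mk by blast
        ultimately have "b x x = b m m" by (simp add: mk(1) form_add[OF b sym])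
        then have "m = 0" using neg[OF mk(2)] P(3)[of x] x by force
        then have xk: "x = k" using mk(1) by simp
        have "b k v = 0" if v: "v \<in> V" for v
        proof -
          obtain y z where yz: "v = y + z" "y \<in> N" "z \<in> P" using v V_sum(2) by blast
          have "b k z = 0"
            using psd_isotropic_imp_radical[OF b sym P(1,3) _ \<open>b k k = 0\<close> yz(3)] x xk by blast
          moreover have "b k y = 0" using NP[OF yz(2), of k] x xk sym[of k y] by simp
          ultimately show ?thesis by (simp add: yz(1) bilinear_radd[OF b])
        qed
        then have "k = 0" using nondeg[OF mk(3)] by blast
        then show "x \<in> {0}" using xk by simp
      qed
    qed
    ultimately show "neg_index W ?q + neg_index U ?q + dim (W \<inter> U) \<le> neg_index V ?q"
      using V_sum(1) N(4) N1(4) N2(4) by linarith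
  qed
qed

text \<open>The index does not change under a linear isomorphism nor under scaling by a positive constant;
  the latter absorbs the factor one half in the cost.\<close>
lemma neg_index_image:
  fixes f :: "'v::real_vector \<Rightarrow> 'w::real_vector"
  assumes f: "linear f" "inj_on f V" and V: "subspace V"
    and c: "c > 0" and q: "\<And>v. v \<in> V \<Longrightarrow> q (f v) = c * r v"
  shows "neg_index (f ` V) q = neg_index V r"
proof -
  have nd: "negative_definite_on (f ` W) q \<longleftrightarrow> negative_definite_on W r" if W: "subspace W" "W \<subseteq> V" for W
  proof -
    have "q (f w) < 0 \<longleftrightarrow> r w < 0" if "w \<in> W" for w
      using q[of w] W(2) that c by (auto simp: mult_less_0_iff)
    moreover have "f w = 0 \<longleftrightarrow> w = 0" if "w \<in> W" for w
      using inj_onD[OF f(2), of w 0] linear_0[OF f(1)] that W(2) subspace_0[OF V] by auto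
    ultimately show ?thesis by (simp add: negative_definite_on_def)
  qed
  have "{dim W | W. subspace W \<and> W \<subseteq> f ` V \<and> negative_definite_on W q}
    = {dim W | W. subspace W \<and> W \<subseteq> V \<and> negative_definite_on W r}" (is "?L = ?R")
  proof (intro equalityI subsetI)
    fix d assume "d \<in> ?L"
    then obtain W where W: "d = dim W" "subspace W" "W \<subseteq> f ` V" "negative_definite_on W q" by blast
    let ?W = "{v \<in> V. f v \<in> W}"
    have sub: "subspace ?W"
      using subspace_inter[OF V linear_subspace_linear_preimage[OF f(1) W(2)]]
      by (simp add: Int_def)
    have img: "f ` ?W = W" using W(3) by blast
    have "inj_on f ?W" using f(2) by (rule inj_on_subset) blast
    then have "dim ?W = d" using dim_image_inj_on[OF f(1) sub] img W(1) by simp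
    moreover have "negative_definite_on ?W r" using nd[OF sub] img W(4) by auto
    ultimately show "d \<in> ?R" using sub by (intro CollectI exI[of _ ?W]) auto
  next
    fix d assume "d \<in> ?R"
    then obtain W where W: "d = dim W" "subspace W" "W \<subseteq> V" "negative_definite_on W r" by blast
    have "dim (f ` W) = d"
      using dim_image_inj_on[OF f(1) W(2)] inj_on_subset[OF f(2) W(3)] W(1) by simp
    moreover have "subspace (f ` W)" using linear_subspace_image[OF f(1) W(2)] .
    ultimately show "d \<in> ?L" using nd[OF W(2,3)] W(3,4) by (intro CollectI exI[of _ "f ` W"]) auto
  qed
  then show ?thesis by (simp add: neg_index_def)
qed

section \<open>Inverses and transposes of square matrices\<close>

lemma transpose_inner: "(transpose M *v x) \<bullet> y = x \<bullet> (M *v y)" for M :: "real ^ 'n ^ 'm"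
  by (simp add: dot_lmul_matrix)

lemma matrix_vector_mult_minus: "M *v - x = - (M *v x)" for M :: "real ^ 'n ^ 'm"
  using matrix_vector_mult_scaleR[of M "-1" x] by simp

lemma matrix_inv_mult:
  fixes M :: "real ^ 'n ^ 'n"
  assumes "invertible M"
  shows "M ** matrix_inv M = mat 1" "matrix_inv M ** M = mat 1"
  using someI_ex[OF assms[unfolded invertible_def]] unfolding matrix_inv_def by auto

lemma matrix_inv_mult_vector:
  fixes M :: "real ^ 'n ^ 'n"
  assumes "invertible M"
  shows "M *v (matrix_inv M *v x) = x" "matrix_inv M *v (M *v x) = x"
  by (simp_all add: matrix_vector_mul_assoc matrix_inv_mult[OF assms])

lemma matrix_inv_unique:
  fixes M :: "real ^ 'n ^ 'n"
  assumes "M ** N = mat 1"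
  shows "matrix_inv M = N"
proof -
  have "invertible M" using assms invertible_right_inverse by blast
  then have "matrix_inv M = matrix_inv M ** (M ** N)" using assms by simp
  also have "\<dots> = N" using matrix_inv_mult(2)[OF \<open>invertible M\<close>] by (simp add: matrix_mul_assoc)
  finally show ?thesis .
qed

lemma invertible_mult_eq_0:
  fixes M :: "real ^ 'n ^ 'n"
  assumes "invertible M" "M *v x = 0"
  shows "x = 0"
  using matrix_inv_mult_vector(2)[OF assms(1), of x] assms(2) by simp

lemma invertible_cancel:
  fixes M :: "real ^ 'n ^ 'n"
  assumes "invertible M" "M *v x = M *v y"
  shows "x = y"
  using assms by (metis matrix_inv_mult_vector(2))

lemma transpose_inv_mult_vector:
  fixes M :: "real ^ 'n ^ 'n"
  assumes "invertible M"
  shows "transpose M *v (transpose (matrix_inv M) *v x) = x"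
proof -
  have "transpose M ** transpose (matrix_inv M) = mat 1"
    using matrix_inv_mult(2)[OF assms] by (simp add: matrix_transpose_mul[symmetric])
  then show ?thesis by (simp add: matrix_vector_mul_assoc del: transpose_matrix_vector)
qed

section \<open>Admissible pairs\<close>

abbreviation "lkp \<equiv> Poly_Mapping.lookup"

lemma lookup_scaleR [simp]:
  fixes x :: "'a \<Rightarrow>\<^sub>0 'b::real_vector"
  shows "lkp (c *\<^sub>R x) k = c *\<^sub>R lkp x k"
proof -
  have "finite {i. c *\<^sub>R lkp x i \<noteq> 0}"
    by (rule finite_subset[OF _ finite_lookup[of x]]) auto
  then show ?thesis by (simp add: scaleR_poly_mapping_def Abs_poly_mapping_inverse)
qed

text \<open>Cutting off after time \<open>n\<close> makes an arbitrary sequence finitely supported.\<close>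
definition seq_of :: "nat \<Rightarrow> (nat \<Rightarrow> real ^ 'n) \<Rightarrow> 'n seq" where
  "seq_of n g = Abs_poly_mapping (\<lambda>i. if i \<le> n then g i else 0)"

lemma lookup_seq_of: "lkp (seq_of n g) i = (if i \<le> n then g i else 0)"
proof -
  have "finite {i. (if i \<le> n then g i else 0) \<noteq> 0}"
    by (rule finite_subset[of _ "{..n}"]) (auto split: if_splits)
  then show ?thesis unfolding seq_of_def by (simp add: Abs_poly_mapping_inverse)
qed

text \<open>The final state condition at time \<open>N + 1\<close> and the vanishing of states beyond it merge into
  the single condition that states vanish after time \<open>N\<close>; this makes the conditions for states and
  controls parallel and the extension to a longer horizon immediate.\<close>
lemma admissibleD:
  assumes "p \<in> admissible N A B"
  shows "\<And>k. k > N \<Longrightarrow> lkp (fst p) k = 0" "\<And>k. k > N \<Longrightarrow> lkp (snd p) k = 0"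
    and "lkp (fst p) 0 = 0"
    and "\<And>k. k \<le> N \<Longrightarrow> lkp (fst p) (Suc k) = P_fwd A k *v lkp (fst p) k + B k *v lkp (snd p) k"
proof -
  obtain x u where p: "p = (x, u)" by fastforce
  have *: "\<forall>k > N + 1. lkp x k = 0" "\<forall>k > N. lkp u k = 0"
    "\<forall>k \<le> N. lkp x (k + 1) - lkp x k = A k *v lkp x k + B k *v lkp u k"
    "lkp x 0 = 0" "lkp x (N + 1) = 0"
    using assms unfolding p admissible_def by auto
  show "lkp (fst p) k = 0" if "k > N" for k
    using *(1,5) that by (cases "k = N + 1") (auto simp: p)
  show "lkp (snd p) k = 0" if "k > N" for k using *(2) that by (simp add: p)
  show "lkp (fst p) 0 = 0" using *(4) by (simp add: p)
  show "lkp (fst p) (Suc k) = P_fwd A k *v lkp (fst p) k + B k *v lkp (snd p) k" if "k \<le> N" for k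
    using *(3)[rule_format, OF that]
    by (simp add: p P_fwd_def matrix_vector_mult_add_rdistrib algebra_simps)
qed

lemma admissibleI:
  assumes "\<And>k. k > N \<Longrightarrow> lkp x k = 0" "\<And>k. k > N \<Longrightarrow> lkp u k = 0" "lkp x 0 = 0"
    and "\<And>k. k \<le> N \<Longrightarrow> lkp x (Suc k) = P_fwd A k *v lkp x k + B k *v lkp u k"
  shows "(x, u) \<in> admissible N A B"
  using assms by (simp add: admissible_def P_fwd_def matrix_vector_mult_add_rdistrib)

lemma admissible_mono_Suc:
  "admissible m A B \<subseteq> admissible (Suc m) A B"
proof
  fix p assume p: "p \<in> admissible m A B"
  note D = admissibleD[OF p]
  have "(fst p, snd p) \<in> admissible (Suc m) A B"
    using D by (intro admissibleI) (auto simp: le_Suc_eq)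
  then show "p \<in> admissible (Suc m) A B" by simp
qed

lemma admissible_0:
  assumes "invertible (B 0)"
  shows "admissible 0 A B = {0}"
proof (intro equalityI subsetI)
  fix p assume p: "p \<in> admissible 0 A B"
  note D = admissibleD[OF p]
  have "lkp (snd p) 0 = 0"
    using D(1)[of "Suc 0"] D(3) D(4)[of 0] invertible_mult_eq_0[OF assms] by simp
  then have "lkp (fst p) k = 0 \<and> lkp (snd p) k = 0" for k
    using D(1-3) by (cases "k = 0") auto
  then show "p \<in> {0}" by (simp add: prod_eq_iff poly_mapping_eq_iff fun_eq_iff)
qed (use subspace_0[OF subspace_admissible] in auto)

text \<open>Fixing the state at time \<open>m + 1\<close> to be zero forces the control at that time to be zero, because
  \<open>B\<close> is invertible, and thus returns to horizon \<open>m\<close>. So each step adds at most \<open>n\<close>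
  dimensions.\<close>
lemma admissible_finite_span:
  assumes "\<And>k. k \<le> m \<Longrightarrow> invertible (B k)"
  shows "\<exists>F. finite F \<and> admissible m A B \<subseteq> span F"
  using assms
proof (induction m)
  case 0
  then show ?case using admissible_0[of B A] by (intro exI[of _ "{}"]) simp
next
  case (Suc m)
  then obtain F where F: "finite F" "admissible m A B \<subseteq> span F" by auto
  let ?f = "\<lambda>p :: 'a seq \<times> 'a seq. lkp (fst p) (Suc m)"
  have f: "linear ?f" by (rule linearI) (simp_all add: lookup_add)
  have "{p \<in> admissible (Suc m) A B. ?f p = 0} \<subseteq> admissible m A B"
  proof
    fix p assume "p \<in> {p \<in> admissible (Suc m) A B. ?f p = 0}"
    then have ad: "p \<in> admissible (Suc m) A B" and 0: "lkp (fst p) (Suc m) = 0" by auto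
    note D = admissibleD[OF ad]
    have "B (Suc m) *v lkp (snd p) (Suc m) = 0"
      using D(1)[of "Suc (Suc m)"] D(4)[of "Suc m"] 0 by simp
    then have u: "lkp (snd p) (Suc m) = 0"
      by (rule invertible_mult_eq_0[OF Suc.prems[OF order_refl]])
    have "(fst p, snd p) \<in> admissible m A B"
    proof (rule admissibleI)
      fix k assume "k > m"
      then have "k = Suc m \<or> k > Suc m" by auto
      then show "lkp (fst p) k = 0" "lkp (snd p) k = 0" using D(1,2) 0 u by auto
    qed (use D(3,4) in simp_all)
    then show "p \<in> admissible m A B" by simp
  qed
  then have "{p \<in> admissible (Suc m) A B. ?f p = 0} \<subseteq> span F" using F(2) by blast
  moreover have "?f ` admissible (Suc m) A B \<subseteq> span Basis" by simp
  ultimately have "\<exists>T. finite T \<and> card T \<le> card F + dim (?f ` admissible (Suc m) A B)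
      \<and> admissible (Suc m) A B \<subseteq> span T"
    by (rule spanning_set_from_kernel_and_image[OF f subspace_admissible F(1) _ finite_Basis])
  then show ?case by blast
qed

section \<open>The polar form of the cost\<close>

definition J_bilinear ::
  "nat \<Rightarrow> (nat \<Rightarrow> real ^ 'n ^ 'n) \<Rightarrow> 'n seq \<times> 'n seq \<Rightarrow> 'n seq \<times> 'n seq \<Rightarrow> real" where
  "J_bilinear N Q p r = 1 / 2 * (\<Sum>i = 0..N.
     lkp (snd p) i \<bullet> lkp (snd r) i - (Q i *v lkp (fst p) i) \<bullet> lkp (fst r) i)"

lemma J_form_eq_J_bilinear: "J_form N Q p = J_bilinear N Q p p"
  by (simp add: J_form_def J_bilinear_def case_prod_beta power2_norm_eq_inner)

lemma bilinear_J_bilinear: "bilinear (J_bilinear N Q)"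
  unfolding bilinear_def
  by (auto intro!: linearI simp: J_bilinear_def lookup_add inner_add_left inner_add_right
      matrix_vector_right_distrib matrix_vector_mult_scaleR sum.distrib[symmetric]
      distrib_left[symmetric] sum_distrib_left intro!: sum.cong) 
   (simp_all add: field_simps)

lemma J_bilinear_commute:
  assumes "\<And>k. k \<le> N \<Longrightarrow> transpose (Q k) = Q k"
  shows "J_bilinear N Q p r = J_bilinear N Q r p"
proof -
  have "(Q i *v x) \<bullet> y = (Q i *v y) \<bullet> x" if "i \<le> N" for i x y
    using transpose_inner[of "Q i" x y] assms[OF that] by (simp add: inner_commute)
  then show ?thesis unfolding J_bilinear_def
    by (intro arg_cong[where f = "(*) (1 / 2)"] sum.cong) (auto simp: inner_commute)
qed

section \<open>Extremal trajectories\<close>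

lemma block_ul_mult: "block_ul (block a b c d ** M) = a ** block_ul M + b ** block_ll M"
  by (simp add: vec_eq_iff block_ul_def block_ll_def block_def matrix_matrix_mult_def
      UNIV_Plus_UNIV[symmetric] sum.Plus del: UNIV_Plus_UNIV)

lemma block_ll_mult: "block_ll (block a b c d ** M) = c ** block_ul M + d ** block_ll M"
  by (simp add: vec_eq_iff block_ul_def block_ll_def block_def matrix_matrix_mult_def
      UNIV_Plus_UNIV[symmetric] sum.Plus del: UNIV_Plus_UNIV)

lemma Phi_0:
  fixes A B Q :: "nat \<Rightarrow> real ^ 'n ^ 'n"
  shows "Phi1 A B Q 0 *v v = v" "Phi3 A B Q 0 *v v = 0"
proof -
  have "block_ul (mat 1 :: real ^ ('n + 'n) ^ ('n + 'n)) = mat 1"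
    "block_ll (mat 1 :: real ^ ('n + 'n) ^ ('n + 'n)) = 0"
    by (simp_all add: vec_eq_iff block_ul_def block_ll_def mat_def)
  then show "Phi1 A B Q 0 *v v = v" "Phi3 A B Q 0 *v v = 0"
    by (simp_all add: Phi1_def Phi3_def)
qed

lemma
  fixes A B Q :: "nat \<Rightarrow> real ^ 'n ^ 'n"
  shows Phi1_Suc:
  "Phi1 A B Q (Suc k) = transpose (P_bwd A k) ** (Phi1 A B Q k - Q k ** Phi3 A B Q k)"
  and Phi3_Suc:
  "Phi3 A B Q (Suc k) = Gam B k ** Phi1 A B Q (Suc k) + P_fwd A k ** Phi3 A B Q k"
proof -
  have "(- Q k) ** M = - (Q k ** M)" for M :: "real ^ 'n ^ 'n"
    by (simp add: vec_eq_iff matrix_matrix_mult_def sum_negf)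
  then show "Phi1 A B Q (Suc k) = transpose (P_bwd A k) ** (Phi1 A B Q k - Q k ** Phi3 A B Q k)"
    "Phi3 A B Q (Suc k) = Gam B k ** Phi1 A B Q (Suc k) + P_fwd A k ** Phi3 A B Q k"
    by (simp_all add: Phi1_def Phi3_def M_mat_def matrix_mul_assoc[symmetric] block_ul_mult block_ll_mult)
qed

text \<open>With the state \<open>x\<^sub>k = \<Phi>\<^sub>k\<^sup>3 v\<close> and the costate \<open>p\<^sub>k = \<Phi>\<^sub>k\<^sup>1 v\<close>, multiplication by
  \<open>M\<^sub>k\<close> is one step of the discrete Hamiltonian system: this lemma is the costate equation, the next
  one the state equation with the extremal control \<open>u\<^sub>k = B\<^sub>k\<^sup>t p\<^sub>k\<^sub>+\<^sub>1\<close>.\<close>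
lemma costate_step:
  assumes "invertible (mat 1 + A k)"
  shows "transpose (P_fwd A k) *v (Phi1 A B Q (Suc k) *v v)
    = Phi1 A B Q k *v v - Q k *v (Phi3 A B Q k *v v)"
proof -
  have "transpose (P_fwd A k) ** transpose (P_bwd A k) = mat 1"
    using matrix_inv_mult(2)[OF assms]
    by (simp add: P_fwd_def P_bwd_def matrix_transpose_mul[symmetric])
  then show ?thesis
    by (simp add: Phi1_Suc matrix_vector_mul_assoc matrix_mul_assoc
        matrix_vector_mult_diff_rdistrib[symmetric] del: transpose_matrix_vector)
qed

lemma state_step:
  "Phi3 A B Q (Suc k) *v v = P_fwd A k *v (Phi3 A B Q k *v v)
    + B k *v (transpose (B k) *v (Phi1 A B Q (Suc k) *v v))"
  by (simp add: Phi3_Suc Gam_def matrix_vector_mul_assoc matrix_mul_assoc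
      matrix_vector_mult_add_rdistrib del: transpose_matrix_vector)

lemma matrix_inv_Gam:
  assumes "invertible (B k)"
  shows "matrix_inv (Gam B k) = transpose (matrix_inv (B k)) ** matrix_inv (B k)"
proof (rule matrix_inv_unique)
  have "transpose (B k) ** transpose (matrix_inv (B k)) = mat 1"
    using matrix_inv_mult(2)[OF assms] by (simp add: matrix_transpose_mul[symmetric])
  then have "B k ** (transpose (B k) ** transpose (matrix_inv (B k))) ** matrix_inv (B k) = mat 1"
    using matrix_inv_mult(1)[OF assms] by simp
  then show "Gam B k ** (transpose (matrix_inv (B k)) ** matrix_inv (B k)) = mat 1"
    by (simp add: Gam_def matrix_mul_assoc)
qed

text \<open>The two recursions turn each summand into the difference of consecutive values of
  \<open>l i \<bullet> y i\<close>, so the sum telescopes.\<close>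
lemma summation_by_parts:
  fixes P B Q :: "nat \<Rightarrow> real ^ 'n ^ 'n" and l x y w :: "nat \<Rightarrow> real ^ 'n"
  assumes "\<And>i. i \<le> m \<Longrightarrow> transpose (P i) *v l (Suc i) = l i - Q i *v x i"
    and "y 0 = 0" and "\<And>i. i \<le> m \<Longrightarrow> y (Suc i) = P i *v y i + B i *v w i"
  shows "(\<Sum>i = 0..m. (transpose (B i) *v l (Suc i)) \<bullet> w i - (Q i *v x i) \<bullet> y i)
    = l (Suc m) \<bullet> y (Suc m)"
  using assms(1,3)
proof (induction m)
  have step: "(transpose (B i) *v l (Suc i)) \<bullet> w i - (Q i *v x i) \<bullet> y i
    = l (Suc i) \<bullet> y (Suc i) - l i \<bullet> y i"
    if "transpose (P i) *v l (Suc i) = l i - Q i *v x i" "y (Suc i) = P i *v y i + B i *v w i" for i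
  proof -
    have "l (Suc i) \<bullet> y (Suc i) = (transpose (P i) *v l (Suc i)) \<bullet> y i + (transpose (B i) *v l (Suc i)) \<bullet> w i"
      unfolding transpose_inner that(2) by (simp add: inner_add_right)
    then show ?thesis unfolding that(1) by (simp add: inner_diff_left)
  qed
  {
    case 0
    then show ?case using step[of 0] assms(2) by (simp del: transpose_matrix_vector)
  next
    case (Suc m)
    then show ?case using step[of "Suc m"] by (simp del: transpose_matrix_vector)
  }
qed

text \<open>The extremal with initial costate \<open>v\<close>, followed until time \<open>m + 1\<close>; the control at that time
  is the one that brings the state to \<open>0\<close>.\<close>
definition trajectory ::
  "(nat \<Rightarrow> real ^ 'n ^ 'n) \<Rightarrow> (nat \<Rightarrow> real ^ 'n ^ 'n) \<Rightarrow> (nat \<Rightarrow> real ^ 'n ^ 'n)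
    \<Rightarrow> nat \<Rightarrow> real ^ 'n \<Rightarrow> 'n seq \<times> 'n seq" where
  "trajectory A B Q m v =
    (seq_of (Suc m) (\<lambda>i. Phi3 A B Q i *v v),
     seq_of (Suc m) (\<lambda>i. if i \<le> m then transpose (B i) *v (Phi1 A B Q (Suc i) *v v)
       else - (matrix_inv (B i) *v (P_fwd A i *v (Phi3 A B Q i *v v)))))"

lemma linear_trajectory: "linear (trajectory A B Q m)"
  by (rule linearI)
    (auto simp: trajectory_def poly_mapping_eq_iff fun_eq_iff lookup_seq_of lookup_add
      matrix_vector_right_distrib matrix_vector_mult_scaleR scaleR_right_distrib
      simp del: transpose_matrix_vector)

lemma trajectory_admissible:
  assumes "\<And>k. k \<le> Suc m \<Longrightarrow> invertible (B k)"
  shows "trajectory A B Q m v \<in> admissible (Suc m) A B"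
  unfolding trajectory_def
proof (rule admissibleI)
  fix k assume k: "k \<le> Suc m"
  show "lkp (seq_of (Suc m) (\<lambda>i. Phi3 A B Q i *v v)) (Suc k)
    = P_fwd A k *v lkp (seq_of (Suc m) (\<lambda>i. Phi3 A B Q i *v v)) k
      + B k *v lkp (seq_of (Suc m) (\<lambda>i. if i \<le> m then transpose (B i) *v (Phi1 A B Q (Suc i) *v v)
       else - (matrix_inv (B i) *v (P_fwd A i *v (Phi3 A B Q i *v v))))) k"
  proof (cases "k \<le> m")
    case True
    then show ?thesis using state_step[of A B Q k v]
      by (simp add: lookup_seq_of del: transpose_matrix_vector)
  next
    case False
    then show ?thesis using k matrix_inv_mult_vector(1)[OF assms[OF k]]
      by (simp add: lookup_seq_of matrix_vector_mult_minus)
  qed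
qed (simp_all add: lookup_seq_of Phi_0)

text \<open>Only time \<open>m + 1\<close> contributes, since up to time \<open>m\<close> the sum telescopes. In particular the
  right-hand side vanishes for \<open>r\<close> with horizon \<open>m\<close>.\<close>
lemma J_bilinear_trajectory:
  assumes "\<And>k. k \<le> m \<Longrightarrow> invertible (mat 1 + A k)" and r: "r \<in> admissible (Suc m) A B"
  shows "J_bilinear (Suc m) Q (trajectory A B Q m v) r = 1 / 2 *
    ((Phi1 A B Q (Suc m) *v v) \<bullet> lkp (fst r) (Suc m)
     + lkp (snd (trajectory A B Q m v)) (Suc m) \<bullet> lkp (snd r) (Suc m)
     - (Q (Suc m) *v (Phi3 A B Q (Suc m) *v v)) \<bullet> lkp (fst r) (Suc m))"
proof -
  have "(\<Sum>i = 0..m. (transpose (B i) *v (Phi1 A B Q (Suc i) *v v)) \<bullet> lkp (snd r) i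
      - (Q i *v (Phi3 A B Q i *v v)) \<bullet> lkp (fst r) i)
    = (Phi1 A B Q (Suc m) *v v) \<bullet> lkp (fst r) (Suc m)"
    using assms(1) admissibleD(3,4)[OF r]
    by (intro summation_by_parts[where P = "P_fwd A" and l = "\<lambda>i. Phi1 A B Q i *v v"] costate_step) auto
  moreover have "(\<Sum>i = 0..m. lkp (snd (trajectory A B Q m v)) i \<bullet> lkp (snd r) i
      - (Q i *v lkp (fst (trajectory A B Q m v)) i) \<bullet> lkp (fst r) i)
    = (\<Sum>i = 0..m. (transpose (B i) *v (Phi1 A B Q (Suc i) *v v)) \<bullet> lkp (snd r) i
      - (Q i *v (Phi3 A B Q i *v v)) \<bullet> lkp (fst r) i)"
    by (intro sum.cong) (auto simp: trajectory_def lookup_seq_of simp del: transpose_matrix_vector)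
  ultimately show ?thesis
    unfolding J_bilinear_def by (simp add: trajectory_def lookup_seq_of del: transpose_matrix_vector)
qed

text \<open>The last control is \<open>-B\<^sup>-\<^sup>1 P x\<close>, whose squared norm is \<open>\<langle>P\<^sup>t \<Gamma>\<^sup>-\<^sup>1 P x, x\<rangle>\<close>; with the boundary
  term \<open>\<langle>p, x\<rangle>\<close> and the potential \<open>\<langle>Q x, x\<rangle>\<close> this is the quadratic form of
  \<open>\<Q>\<^sup>\<bottom>\<close>, evaluated at \<open>v\<close>.\<close>
lemma J_form_trajectory:
  assumes B: "\<And>k. k \<le> Suc m \<Longrightarrow> invertible (B k)" and A: "\<And>k. k \<le> m \<Longrightarrow> invertible (mat 1 + A k)"
  shows "J_form (Suc m) Q (trajectory A B Q m v) = 1 / 2 * ((Q_perp A B Q (Suc m) *v v) \<bullet> v)"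
proof -
  let ?k = "Suc m"
  let ?x = "Phi3 A B Q ?k *v v" and ?l = "Phi1 A B Q ?k *v v" and ?P = "P_fwd A ?k" and ?B = "matrix_inv (B ?k)"
  have "(Q_perp A B Q ?k *v v) \<bullet> v = (transpose (Phi3 A B Q ?k) *v
      ((transpose ?P ** matrix_inv (Gam B ?k) ** ?P - Q ?k) *v ?x + ?l)) \<bullet> v"
    by (simp add: Q_perp_def matrix_vector_mult_add_rdistrib matrix_vector_right_distrib
        matrix_vector_mul_assoc matrix_mul_assoc del: transpose_matrix_vector)
  also have "\<dots> = ((transpose ?P ** matrix_inv (Gam B ?k) ** ?P - Q ?k) *v ?x + ?l) \<bullet> ?x"
    by (rule transpose_inner)
  also have "(transpose ?P ** matrix_inv (Gam B ?k) ** ?P - Q ?k) *v ?x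
     = transpose ?P *v (transpose ?B *v (?B *v (?P *v ?x))) - Q ?k *v ?x"
    unfolding matrix_vector_mult_diff_rdistrib
    by (simp add: matrix_inv_Gam[OF B] matrix_vector_mul_assoc matrix_mul_assoc del: transpose_matrix_vector)
  finally have "(Q_perp A B Q ?k *v v) \<bullet> v
    = (?B *v (?P *v ?x)) \<bullet> (?B *v (?P *v ?x)) - (Q ?k *v ?x) \<bullet> ?x + ?l \<bullet> ?x"
    by (simp only: inner_add_left inner_diff_left transpose_inner)
  moreover have "J_bilinear (Suc m) Q (trajectory A B Q m v) (trajectory A B Q m v) = 1 / 2 *
    (?l \<bullet> lkp (fst (trajectory A B Q m v)) ?k
     + lkp (snd (trajectory A B Q m v)) ?k \<bullet> lkp (snd (trajectory A B Q m v)) ?k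
     - (Q ?k *v ?x) \<bullet> lkp (fst (trajectory A B Q m v)) ?k)"
    using trajectory_admissible[where B = B, OF B] A by (intro J_bilinear_trajectory)
  ultimately show ?thesis
    unfolding J_form_eq_J_bilinear by (simp add: trajectory_def lookup_seq_of)
qed

text \<open>If the state at time \<open>m + 1\<close> is zero, so is the control that brings it to zero.\<close>
lemma trajectory_mem_iff:
  assumes "\<And>k. k \<le> Suc m \<Longrightarrow> invertible (B k)"
  shows "trajectory A B Q m v \<in> admissible m A B \<longleftrightarrow> Phi3 A B Q (Suc m) *v v = 0"
proof
  assume "trajectory A B Q m v \<in> admissible m A B"
  from admissibleD(1)[OF this, of "Suc m"] show "Phi3 A B Q (Suc m) *v v = 0"
    by (simp add: trajectory_def lookup_seq_of)
next
  assume 0: "Phi3 A B Q (Suc m) *v v = 0"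
  note ad = admissibleD[OF trajectory_admissible[OF assms, where A = A and Q = Q and v = v], simplified]
  have "(fst (trajectory A B Q m v), snd (trajectory A B Q m v)) \<in> admissible m A B"
  proof (rule admissibleI)
    show "lkp (fst (trajectory A B Q m v)) k = 0" "lkp (snd (trajectory A B Q m v)) k = 0" if "k > m" for k
      using that 0 by (auto simp: trajectory_def lookup_seq_of le_Suc_eq)
  qed (use ad in auto)
  then show "trajectory A B Q m v \<in> admissible m A B" by simp
qed

lemma inj_trajectory:
  assumes B: "invertible (B 0)" and A: "invertible (mat 1 + A 0)"
  shows "inj (trajectory A B Q m)"
  unfolding linear_injective_0[OF linear_trajectory]
proof (intro allI impI)
  fix v assume "trajectory A B Q m v = 0"
  then have "lkp (snd (trajectory A B Q m v)) 0 = 0" by (simp add: zero_prod_def)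
  then have "transpose (B 0) *v (Phi1 A B Q (Suc 0) *v v) = 0"
    by (simp add: trajectory_def lookup_seq_of del: transpose_matrix_vector)
  then have "Phi1 A B Q (Suc 0) *v v = 0"
    using transpose_invertible[OF B] invertible_mult_eq_0 by blast
  then show "v = 0" using costate_step[where A = A and k = 0, OF A, of B Q v] by (simp add: Phi_0)
qed

section \<open>Euler-Lagrange equations\<close>

text \<open>The state is displaced by \<open>e\<close> at the single time \<open>j + 1\<close>, for which the controls before and
  after that time compensate.\<close>
definition variation ::
  "(nat \<Rightarrow> real ^ 'n ^ 'n) \<Rightarrow> (nat \<Rightarrow> real ^ 'n ^ 'n) \<Rightarrow> nat \<Rightarrow> real ^ 'n \<Rightarrow> 'n seq \<times> 'n seq" where
  "variation A B j e =
    (seq_of (Suc j) (\<lambda>k. if k = Suc j then e else 0),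
     seq_of (Suc j) (\<lambda>k. if k = j then matrix_inv (B j) *v e
       else if k = Suc j then - (matrix_inv (B k) *v (P_fwd A k *v e)) else 0))"

lemma variation_admissible:
  assumes "j < N" and "\<And>k. k \<le> N \<Longrightarrow> invertible (B k)"
  shows "variation A B j e \<in> admissible N A B"
  unfolding variation_def
  using assms
  by (intro admissibleI)
    (auto simp: lookup_seq_of matrix_inv_mult_vector matrix_vector_mult_minus not_le)

lemma J_bilinear_variation:
  assumes "j < N"
  shows "J_bilinear N Q p (variation A B j e) = 1 / 2 *
    (lkp (snd p) j \<bullet> (matrix_inv (B j) *v e)
     - lkp (snd p) (Suc j) \<bullet> (matrix_inv (B (Suc j)) *v (P_fwd A (Suc j) *v e))
     - (Q (Suc j) *v lkp (fst p) (Suc j)) \<bullet> e)"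
proof -
  let ?t = "\<lambda>i. lkp (snd p) i \<bullet> lkp (snd (variation A B j e)) i
     - (Q i *v lkp (fst p) i) \<bullet> lkp (fst (variation A B j e)) i"
  have "(\<Sum>i = 0..N. ?t i) = (\<Sum>i\<in>{j, Suc j}. ?t i)"
    using assms by (intro sum.mono_neutral_right) (auto simp: variation_def lookup_seq_of)
  then show ?thesis
    unfolding J_bilinear_def by (simp add: variation_def lookup_seq_of)
qed

text \<open>The costate is recovered from the control as \<open>p\<^sub>k\<^sub>+\<^sub>1 = (B\<^sub>k\<^sup>-\<^sup>1)\<^sup>t u\<^sub>k\<close>. In these terms,
  orthogonality to the variations at time \<open>j + 1\<close> is the costate equation at that time.\<close>
lemma euler_lagrange:
  assumes j: "j < N" and ort: "\<And>e. J_bilinear N Q p (variation A B j e) = 0"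
  shows "transpose (matrix_inv (B j)) *v lkp (snd p) j
    = transpose (P_fwd A (Suc j)) *v (transpose (matrix_inv (B (Suc j))) *v lkp (snd p) (Suc j))
      + Q (Suc j) *v lkp (fst p) (Suc j)" (is "?l = ?r")
proof -
  have "(?l - ?r) \<bullet> e = 0" for e
    using ort[of e] unfolding J_bilinear_variation[OF j]
    by (simp add: inner_diff_left inner_add_left transpose_inner algebra_simps del: transpose_matrix_vector)
  then have "?l - ?r = 0" by (metis inner_eq_zero_iff)
  then show ?thesis by simp
qed

text \<open>Trajectories are orthogonal to the shorter horizon by \<open>J_bilinear_trajectory\<close>. Conversely, the
  Euler-Lagrange equations determine the costates from the first one and, with the dynamics, the
  states; the last control is determined by the final condition.\<close>
lemma orthogonal_complement_eq_trajectories: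
  assumes B: "\<And>k. k \<le> Suc m \<Longrightarrow> invertible (B k)" and A: "\<And>k. k \<le> m \<Longrightarrow> invertible (mat 1 + A k)"
  shows "{p \<in> admissible (Suc m) A B. \<forall>r\<in>admissible m A B. J_bilinear (Suc m) Q p r = 0}
    = range (trajectory A B Q m)"
proof (intro equalityI subsetI)
  fix p assume "p \<in> range (trajectory A B Q m)"
  then obtain v where p: "p = trajectory A B Q m v" by blast
  have "J_bilinear (Suc m) Q p r = 0" if "r \<in> admissible m A B" for r
  proof -
    have "r \<in> admissible (Suc m) A B" using that admissible_mono_Suc by blast
    from J_bilinear_trajectory[OF A this] show ?thesis
      using admissibleD(1,2)[OF that, of "Suc m"] by (simp add: p)
  qed
  then show "p \<in> {p \<in> admissible (Suc m) A B. \<forall>r\<in>admissible m A B. J_bilinear (Suc m) Q p r = 0}"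
    using trajectory_admissible[where B = B, OF B] p by blast
next
  fix p assume "p \<in> {p \<in> admissible (Suc m) A B. \<forall>r\<in>admissible m A B. J_bilinear (Suc m) Q p r = 0}"
  then have ad: "p \<in> admissible (Suc m) A B"
    and ort: "\<And>r. r \<in> admissible m A B \<Longrightarrow> J_bilinear (Suc m) Q p r = 0" by auto
  note pD = admissibleD[OF ad]
  \<comment> \<open>\<open>l k\<close> is the costate at time \<open>k + 1\<close>\<close>
  define l where "l k = transpose (matrix_inv (B k)) *v lkp (snd p) k" for k
  have Bl: "transpose (B k) *v l k = lkp (snd p) k" if "k \<le> Suc m" for k
    unfolding l_def using transpose_inv_mult_vector[OF B[OF that]] .
  have EL: "l j = transpose (P_fwd A (Suc j)) *v l (Suc j) + Q (Suc j) *v lkp (fst p) (Suc j)"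
    if "j < m" for j
    unfolding l_def
    using that ort[OF variation_admissible[OF that]] B by (intro euler_lagrange[where N = "Suc m"]) auto
  have inj: "invertible (transpose (P_fwd A k))" if "k \<le> m" for k
    using transpose_invertible[OF A[OF that]] by (simp add: P_fwd_def)
  \<comment> \<open>the costate equation at time \<open>0\<close>, where the state vanishes\<close>
  define v where "v = transpose (P_fwd A 0) *v l 0"
  have agree: "l i = Phi1 A B Q (Suc i) *v v \<and> lkp (fst p) (Suc i) = Phi3 A B Q (Suc i) *v v"
    if "i \<le> m" for i
    using that
  proof (induction i)
    case 0
    have "transpose (P_fwd A 0) *v (Phi1 A B Q (Suc 0) *v v) = transpose (P_fwd A 0) *v l 0"
      using costate_step[where A = A and k = 0, OF A[OF le0], of B Q v] by (simp add: Phi_0 v_def)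
    then have l: "l 0 = Phi1 A B Q (Suc 0) *v v" using invertible_cancel[OF inj[OF le0]] by metis
    moreover have "lkp (fst p) (Suc 0) = Phi3 A B Q (Suc 0) *v v"
      unfolding state_step l[symmetric] using pD(3) pD(4)[of 0] Bl[of 0]
      by (simp add: Phi_0 del: transpose_matrix_vector)
    ultimately show ?case by simp
  next
    case (Suc i)
    then have IH: "l i = Phi1 A B Q (Suc i) *v v" "lkp (fst p) (Suc i) = Phi3 A B Q (Suc i) *v v" by auto
    have "transpose (P_fwd A (Suc i)) *v (Phi1 A B Q (Suc (Suc i)) *v v)
      = transpose (P_fwd A (Suc i)) *v l (Suc i)"
      using costate_step[where A = A and k = "Suc i", OF A[OF Suc.prems], of B Q v] EL[of i] IH Suc.prems
      by (simp del: transpose_matrix_vector)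
    then have l: "l (Suc i) = Phi1 A B Q (Suc (Suc i)) *v v"
      using invertible_cancel[OF inj[OF Suc.prems]] by metis
    moreover have "lkp (fst p) (Suc (Suc i)) = Phi3 A B Q (Suc (Suc i)) *v v"
      unfolding state_step[where k = "Suc i"] l[symmetric]
      using pD(4)[of "Suc i"] Bl[of "Suc i"] IH Suc.prems
      by (simp del: transpose_matrix_vector)
    ultimately show ?case by simp
  qed
  have x: "lkp (fst p) k = Phi3 A B Q k *v v" if "k \<le> Suc m" for k
    using that agree pD(3) by (cases k) (auto simp: Phi_0)
  have u: "lkp (snd p) k = transpose (B k) *v (Phi1 A B Q (Suc k) *v v)" if "k \<le> m" for k
    using Bl[of k] agree[OF that] that by simp
  have "B (Suc m) *v lkp (snd p) (Suc m) = - (P_fwd A (Suc m) *v (Phi3 A B Q (Suc m) *v v))"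
    using pD(1)[of "Suc (Suc m)"] pD(4)[of "Suc m"] x[of "Suc m"] by (simp add: eq_neg_iff_add_eq_0 add.commute)
  then have uN: "lkp (snd p) (Suc m) = - (matrix_inv (B (Suc m)) *v (P_fwd A (Suc m) *v (Phi3 A B Q (Suc m) *v v)))"
    using matrix_inv_mult_vector(2)[OF B[OF order_refl], of "lkp (snd p) (Suc m)"]
    by (simp add: matrix_vector_mult_minus)
  have "p = trajectory A B Q m v"
    unfolding trajectory_def
    using x u uN pD(1,2)
    by (auto simp: prod_eq_iff poly_mapping_eq_iff fun_eq_iff lookup_seq_of le_Suc_eq
        simp del: transpose_matrix_vector)
  then show "p \<in> range (trajectory A B Q m)" by blast
qed

text \<open>Backward uniqueness for the Hamiltonian system: state and control vanish at time \<open>m + 1\<close>, then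
  the Euler-Lagrange equation gives the preceding control and the invertible dynamics the preceding
  state.\<close>
lemma no_radical_in_shorter_horizon:
  assumes B: "\<And>k. k \<le> Suc m \<Longrightarrow> invertible (B k)" and A: "\<And>k. k \<le> m \<Longrightarrow> invertible (mat 1 + A k)"
    and p: "p \<in> admissible m A B"
    and ort: "\<And>r. r \<in> admissible (Suc m) A B \<Longrightarrow> J_bilinear (Suc m) Q p r = 0"
  shows "p = 0"
proof -
  note D = admissibleD[OF p]
  have zero: "lkp (fst p) k = 0 \<and> lkp (snd p) k = 0" if "k \<le> Suc m" for k
    using that
  proof (induction k rule: inc_induct)
    case base
    then show ?case using D(1,2) by simp
  next
    case (step k)
    then have k: "k \<le> m" "k < Suc m" by auto
    have "transpose (matrix_inv (B k)) *v lkp (snd p) k = 0"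
      using euler_lagrange[OF k(2), where Q = Q and p = p and A = A and B = B]
        ort[OF variation_admissible[OF k(2)]] B step.IH
      by (simp del: transpose_matrix_vector)
    then have u: "lkp (snd p) k = 0"
      using transpose_inv_mult_vector[OF B, of k "lkp (snd p) k"] k by simp
    then have "P_fwd A k *v lkp (fst p) k = 0" using D(4)[OF k(1)] step.IH by simp
    then have "lkp (fst p) k = 0"
      using invertible_mult_eq_0[OF A[OF k(1)]] by (simp add: P_fwd_def)
    with u show ?case by simp
  qed
  have "lkp (fst p) k = 0 \<and> lkp (snd p) k = 0" for k
    using zero[of k] D(1,2) by (cases "k \<le> Suc m") auto
  then show "p = 0" by (simp add: prod_eq_iff poly_mapping_eq_iff fun_eq_iff)
qed

section \<open>Adding one time step\<close>

lemma neg_index_admissible_Suc: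
  fixes A B Q :: "nat \<Rightarrow> real ^ 'n ^ 'n"
  assumes B: "\<And>k. k \<le> Suc m \<Longrightarrow> invertible (B k)" and A: "\<And>k. k \<le> Suc m \<Longrightarrow> invertible (mat 1 + A k)"
    and Q: "\<And>k. k \<le> Suc m \<Longrightarrow> transpose (Q k) = Q k"
  shows "neg_index (admissible (Suc m) A B) (J_form (Suc m) Q)
    = neg_index (admissible m A B) (J_form m Q)
      + (neg_index_matrix (Q_perp A B Q (Suc m)) + dim {v. Phi3 A B Q (Suc m) *v v = 0})"
proof -
  let ?V = "admissible (Suc m) A B" and ?W = "admissible m A B" and ?b = "J_bilinear (Suc m) Q"
    and ?f = "trajectory A B Q m"
  have A': "invertible (mat 1 + A k)" if "k \<le> m" for k using A that by simp
  have inj: "inj_on ?f S" for S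
    using inj_trajectory[where A = A and B = B] B A by (meson inj_on_subset subset_UNIV le0)
  obtain F where F: "finite F" "?V \<subseteq> span F" using admissible_finite_span[of "Suc m" B] B by blast
  have U: "range ?f = {p \<in> ?V. \<forall>r\<in>?W. ?b p r = 0}"
    using orthogonal_complement_eq_trajectories[where A = A and B = B, OF B A'] by blast
  have "neg_index ?V (\<lambda>p. ?b p p)
    = neg_index ?W (\<lambda>p. ?b p p) + neg_index (range ?f) (\<lambda>p. ?b p p) + dim (?W \<inter> range ?f)"
  proof (rule neg_index_orthogonal_decomposition[OF bilinear_J_bilinear _ subspace_admissible F(2,1)
        subspace_admissible admissible_mono_Suc U])
    show "?b p r = ?b r p" for p r by (rule J_bilinear_commute[OF Q])
    show "k = 0" if "k \<in> ?W" "\<And>v. v \<in> ?V \<Longrightarrow> ?b k v = 0" for k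
      using no_radical_in_shorter_horizon[where A = A and B = B, OF B A' that] .
  qed
  moreover have "neg_index ?W (\<lambda>p. ?b p p) = neg_index ?W (J_form m Q)"
  proof -
    have "?b p p = 1 * J_form m Q p" if "p \<in> ?W" for p
      using admissibleD(1,2)[OF that, of "Suc m"]
      by (simp add: J_form_eq_J_bilinear J_bilinear_def)
    then have "neg_index (id ` ?W) (\<lambda>p. ?b p p) = neg_index ?W (J_form m Q)"
      by (intro neg_index_image[where c = 1] linear_id inj_on_id subspace_admissible) auto
    then show ?thesis by simp
  qed
  moreover have "neg_index (range ?f) (\<lambda>p. ?b p p) = neg_index_matrix (Q_perp A B Q (Suc m))"
    unfolding neg_index_matrix_def
    using J_form_trajectory[where A = A and B = B, OF B A', where Q = Q]
    by (intro neg_index_image[where c = "1 / 2"] linear_trajectory inj)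
      (auto simp: J_form_eq_J_bilinear)
  moreover have "dim (?W \<inter> range ?f) = dim {v. Phi3 A B Q (Suc m) *v v = 0}"
  proof -
    have "?W \<inter> range ?f = ?f ` {v. Phi3 A B Q (Suc m) *v v = 0}"
      using trajectory_mem_iff[where A = A and B = B and Q = Q, OF B] by blast
    moreover have "subspace {v. Phi3 A B Q (Suc m) *v v = 0}"
      by (rule linear_subspace_kernel) simp
    ultimately show ?thesis
      using dim_image_inj_on[OF linear_trajectory _ inj] by simp
  qed
  ultimately show ?thesis by (simp add: J_form_eq_J_bilinear[abs_def])
qed

theorem theorem1:
  fixes N :: nat and A B Q :: "nat \<Rightarrow> real ^ 'n ^ 'n"
  assumes "N \<ge> 1"
    and "\<And>k. k \<le> N \<Longrightarrow> invertible (B k)"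
    and "\<And>k. k \<le> N \<Longrightarrow> invertible (mat 1 + A k)"
    and "\<And>k. k \<le> N \<Longrightarrow> transpose (Q k) = Q k"
  shows "neg_index (admissible N A B) (J_form N Q)
    = (\<Sum>k = 1..N. neg_index_matrix (Q_perp A B Q k) + dim {v. Phi3 A B Q k *v v = 0})"
  using assms(2-4)
proof (induction N)
  case 0
  then show ?case using admissible_0[of B A] by (simp add: neg_index_zero_space)
next
  case (Suc N)
  have "neg_index (admissible N A B) (J_form N Q)
    = (\<Sum>k = 1..N. neg_index_matrix (Q_perp A B Q k) + dim {v. Phi3 A B Q k *v v = 0})"
    using Suc by simp
  then show ?case using neg_index_admissible_Suc[where A = A and B = B and Q = Q and m = N] Suc.prems by simp
qed

end
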